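(* Let $d\geq 2$ and let $G$ be a graph. Then $a_d(G)\leq a(G)$.
   Context: For a graph $G=(V,E)$ and $p:V\to\mathbb R^d$, let $d_{uv}=\frac{p(u)-p(v)}{\|p(u)-p(v)\|}$ if $p(u)\ne p(v)$ and $0$ otherwise; let $R(G,p)\in\mathbb R^{d|V|\times |E|}$ have columns $(1_u-1_v)\otimes d_{uv}$ for $\{u,v\}\in E$ ($1_u$ standard basis vectors, $\otimes$ Kronecker product), and $L(G,p)=R(G,p)R(G,p)^T$. With $\lambda_i$ the $i$-th smallest eigenvalue, $a_d(G)=\sup_{p:V\to\mathbb R^d}\lambda_{\binom{d+1}{2}+1}(L(G,p))$. $a(G)$ is the second smallest eigenvalue of the Laplacian matrix of $G$ (algebraic connectivity).
   Formalization: The formal theorem assumes |V| ≥ d; without it the claim can fail (d=4, G the path on 3 vertices placed with a right angle at the middle gives λ_11 = 2 > 1 = a(G)) or the eigenvalue may not exist (d=3, |V|=2). *)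

theory Defs
  imports
    "HOL-Analysis.Analysis"
    "HOL-Computational_Algebra.Computational_Algebra"
begin

text \<open>The vertex set of a graph is a finite type, and a graph is given by its set of edges.\<close>

definition simple_graph :: "'v::finite set set \<Rightarrow> bool" where
  "simple_graph E \<longleftrightarrow> (\<forall>e\<in>E. card e = 2)"

definition char_poly_mat :: "real^'n^'n \<Rightarrow> real poly" where
  "char_poly_mat A = det (\<chi> i j. (if i = j then [:0, 1:] else 0) - [:A $ i $ j:])"

text \<open>The \<open>i\<close>-th smallest eigenvalue, counted with multiplicity and indexed from 1. The real
  roots of the characteristic polynomial are all of its roots when the matrix is symmetric; the
  value is meaningful for \<open>1 \<le> i\<close> and \<open>i\<close> at most the size of the matrix.\<close>

definition nth_eigenvalue :: "nat \<Rightarrow> real^'n^'n \<Rightarrow> real" where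
  "nth_eigenvalue i A = sorted_list_of_multiset (proots (char_poly_mat A)) ! (i - 1)"

definition laplacian :: "'v::finite set set \<Rightarrow> real^'v^'v" where
  "laplacian E = (\<chi> u v. if u = v then real (card {e\<in>E. u \<in> e})
                        else if {u, v} \<in> E then - 1 else 0)"

definition algebraic_connectivity :: "'v::finite set set \<Rightarrow> real" where
  "algebraic_connectivity E = nth_eigenvalue 2 (laplacian E)"

definition kron_vec :: "real^'m \<Rightarrow> real^'n \<Rightarrow> real^('m \<times> 'n)" where
  "kron_vec x y = (\<chi> k. x $ fst k * y $ snd k)"

definition edge_dir :: "('v \<Rightarrow> real^'d) \<Rightarrow> 'v \<Rightarrow> 'v \<Rightarrow> real^'d" where
  "edge_dir p u v =
     (if p u \<noteq> p v then (1 / norm (p u - p v)) *\<^sub>R (p u - p v) else 0)"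

text \<open>The column does not depend on the chosen order of the endpoints, see
  \<open>edge_column_doubleton\<close> below.\<close>

definition edge_column :: "('v::finite \<Rightarrow> real^'d) \<Rightarrow> 'v set \<Rightarrow> real^('v \<times> 'd)" where
  "edge_column p e =
     (let (u, v) = (SOME (u, v). u \<noteq> v \<and> e = {u, v})
      in kron_vec (axis u 1 - axis v 1) (edge_dir p u v))"

lemma edge_dir_swap: "edge_dir p v u = - edge_dir p u v"
proof -
  have "p v - p u = - (p u - p v)" by simp
  then show ?thesis
    unfolding edge_dir_def by (simp only: norm_minus_cancel scaleR_minus_right) auto
qed

lemma edge_column_doubleton:
  assumes "u \<noteq> v"
  shows "edge_column p {u, v} = kron_vec (axis u 1 - axis v 1) (edge_dir p u v)"
proof -
  let ?P = "\<lambda>(a, b). a \<noteq> b \<and> {u, v} = {a, b}"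
  obtain a b where ab: "(SOME x. ?P x) = (a, b)"
    by (rule prod.exhaust)
  have "?P (SOME x. ?P x)"
    by (rule someI[where x = "(u, v)"]) (use assms in simp)
  then have "{u, v} = {a, b}"
    unfolding ab by simp
  then have cases: "(a = u \<and> b = v) \<or> (a = v \<and> b = u)"
    unfolding doubleton_eq_iff by blast
  have col: "edge_column p {u, v} = kron_vec (axis a 1 - axis b 1) (edge_dir p a b)"
    unfolding edge_column_def ab by simp
  have "kron_vec (axis v 1 - axis u 1) (edge_dir p v u) =
        kron_vec (axis u 1 - axis v 1) (edge_dir p u v)"
    unfolding edge_dir_swap[of p v u] kron_vec_def vec_eq_iff by (simp add: left_diff_distrib)
  with cases col show ?thesis by metis
qed

text \<open>The columns are indexed by all sets of vertices, those that are not edges contributing a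
  zero column; this does not affect the product of the matrix with its transpose.\<close>

definition rigidity_matrix ::
    "'v::finite set set \<Rightarrow> ('v \<Rightarrow> real^'d) \<Rightarrow> real^('v set)^('v \<times> 'd)" where
  "rigidity_matrix E p = (\<chi> k e. if e \<in> E then edge_column p e $ k else 0)"

definition stiffness_matrix ::
    "'v::finite set set \<Rightarrow> ('v \<Rightarrow> real^'d) \<Rightarrow> real^('v \<times> 'd)^('v \<times> 'd)" where
  "stiffness_matrix E p = rigidity_matrix E p ** transpose (rigidity_matrix E p)"

text \<open>The dimension is \<open>CARD('d)\<close>. The supremum is taken in the extended reals, so that it is
  the actual supremum without a boundedness side condition.\<close>

definition algebraic_connectivity_dim :: "'d::finite itself \<Rightarrow> 'v::finite set set \<Rightarrow> ereal" where
  "algebraic_connectivity_dim _ E =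
     (SUP p :: 'v \<Rightarrow> real^'d.
        ereal (nth_eigenvalue (((CARD('d) + 1) choose 2) + 1) (stiffness_matrix E p)))"

end

theory Submission imports Defs begin

text \<open>
  Let \<open>f\<close> be a unit vector orthogonal to the constants whose Laplacian form is at most \<open>a(G)\<close>, and put
  \<open>q = \<Sum>\<^sub>u f(u) p(u)\<close>. Then \<open>f \<otimes> q\<close> is orthogonal to every trivial infinitesimal motion
  \<open>u \<mapsto> A p(u) + b\<close> with \<open>A\<close> skew-symmetric: its inner product with the motion is
  \<open>q \<bullet> A q + (\<Sum>\<^sub>u f(u)) (q \<bullet> b) = 0\<close>. Since edge directions have norm at most 1, the Rayleigh
  quotient of \<open>f \<otimes> q\<close> for the stiffness matrix is at most \<open>a(G)\<close>. (If \<open>q = 0\<close>, any nonzero vector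
  serves in place of \<open>q\<close>.) When the points \<open>p(u)\<close> span the space, the trivial motions have dimension
  \<open>(d + 1) choose 2\<close> and lie in the kernel, so together with \<open>f \<otimes> q\<close> they form a test space for the
  min-max principle. As \<open>d \<le> |V|\<close>, every \<open>p\<close> is a limit of such placements, and in the limit the
  stiffness form can only drop.
\<close>

section \<open>The spectral theorem and the Courant--Fischer principle\<close>

lemma symmetric_matrix_dot:
  fixes A :: "real^'n^'n"
  assumes "transpose A = A"
  shows "x \<bullet> (A *v y) = (A *v x) \<bullet> y"
  by (metis assms dot_lmul_matrix vector_transpose_matrix)

lemma linear_le_quadratic_imp_zero:
  fixes b c :: real
  assumes "\<And>t. b * t \<le> c * t\<^sup>2"
  shows "b = 0"
proof (rule ccontr)
  assume "b \<noteq> 0"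
  \<comment> \<open>This choice gives b * t = (\<bar>c\<bar> + 1) * t^2, which exceeds c * t^2 as
    soon as t is nonzero.\<close>
  define t where "t = b / (\<bar>c\<bar> + 1)"
  have b: "b = t * (\<bar>c\<bar> + 1)" by (simp add: t_def)
  then have "t\<^sup>2 > 0" using \<open>b \<noteq> 0\<close> by auto
  have "(\<bar>c\<bar> + 1) * t\<^sup>2 \<le> c * t\<^sup>2"
    using assms[of t] by (simp add: b power2_eq_square mult_ac)
  then show False
    using \<open>t\<^sup>2 > 0\<close> by (simp add: mult_le_cancel_right_pos)
qed

text \<open>The eigenvector is a maximiser of the quadratic form on the compact unit sphere of
  \<open>S\<close>. Invariance of \<open>S\<close> keeps the residual
  \<open>A *v x - \<mu> *\<^sub>R x\<close> inside \<open>S\<close>, so it is an admissible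
  direction of variation.\<close>

lemma symmetric_eigenvector_in_subspace:
  fixes A :: "real^'n^'n"
  assumes sym: "transpose A = A" and S: "subspace S"
    and inv: "\<And>x. x \<in> S \<Longrightarrow> A *v x \<in> S"
    and "x0 \<in> S" "x0 \<noteq> 0"
  obtains x \<mu> where "x \<in> S" "norm x = 1" "A *v x = \<mu> *\<^sub>R x"
proof -
  have "compact (S \<inter> sphere 0 1)"
    using closed_subspace[OF S] by (simp add: closed_Int_compact)
  moreover have "(1 / norm x0) *\<^sub>R x0 \<in> S \<inter> sphere 0 1"
    using assms by (simp add: subspace_scale)
  moreover have "continuous_on (S \<inter> sphere 0 1) (\<lambda>x. x \<bullet> (A *v x))"
    by (intro continuous_intros linear_continuous_on linear_conv_bounded_linear[THEN iffD1]
        matrix_vector_mul_linear)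
  ultimately obtain x where x: "x \<in> S" "norm x = 1"
    and max: "\<And>y. y \<in> S \<Longrightarrow> norm y = 1 \<Longrightarrow> y \<bullet> (A *v y) \<le> x \<bullet> (A *v x)"
    using continuous_attains_sup[of "S \<inter> sphere 0 1" "\<lambda>x. x \<bullet> (A *v x)"]
    by (smt (verit, best) IntE IntI empty_iff mem_sphere_0)
  define \<mu> where "\<mu> = x \<bullet> (A *v x)"
  have bound: "v \<bullet> (A *v v) \<le> \<mu> * (v \<bullet> v)" if "v \<in> S" for v
  proof (cases "v = 0")
    case False
    let ?y = "(1 / norm v) *\<^sub>R v"
    have "?y \<bullet> (A *v ?y) \<le> \<mu>"
      unfolding \<mu>_def using that False by (intro max) (simp_all add: subspace_scale[OF S])
    then have "(v \<bullet> (A *v v)) / (norm v)\<^sup>2 \<le> \<mu>"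
      by (simp add: matrix_vector_mult_scaleR power2_eq_square)
    then show ?thesis
      using False by (simp add: dot_square_norm divide_le_eq)
  qed simp
  \<comment> \<open>Moving from x to x + t * y changes the two sides of \<open>bound\<close> by
    terms whose linear parts differ by 2 * (y \<bullet> y) * t. Maximality for both signs of t
    forces this coefficient to vanish.\<close>
  define y where "y = A *v x - \<mu> *\<^sub>R x"
  have y: "y \<in> S"
    unfolding y_def using x inv S by (simp add: subspace_diff subspace_scale)
  have xx: "x \<bullet> x = 1"
    using x by (simp add: dot_square_norm)
  have xy: "x \<bullet> y = 0"
    by (simp add: y_def inner_diff_right xx \<mu>_def)
  have yAx: "y \<bullet> (A *v x) = y \<bullet> y"
    using xy by (simp add: y_def inner_diff_right inner_diff_left inner_commute)
  have "2 * (y \<bullet> y) * t \<le> (\<mu> * (y \<bullet> y) - y \<bullet> (A *v y)) * t\<^sup>2" for t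
  proof -
    have "(x + t *\<^sub>R y) \<bullet> (A *v (x + t *\<^sub>R y)) \<le> \<mu> * ((x + t *\<^sub>R y) \<bullet> (x + t *\<^sub>R y))"
      by (intro bound subspace_add[OF S] subspace_scale[OF S] x y)
    moreover have "x \<bullet> (A *v y) = y \<bullet> y"
      using symmetric_matrix_dot[OF sym, of x y] yAx by (simp add: inner_commute)
    ultimately show ?thesis
      using xx xy yAx
      by (simp add: algebra_simps matrix_vector_right_distrib matrix_vector_mult_scaleR
          inner_commute \<mu>_def[symmetric] power2_eq_square)
  qed
  then have "2 * (y \<bullet> y) = 0"
    by (rule linear_le_quadratic_imp_zero)
  then have "A *v x = \<mu> *\<^sub>R x"
    by (simp add: y_def)
  with x show thesis by (rule that)
qed

text \<open>Induction on the number of eigenvectors found: by symmetry their orthogonal complement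
  is invariant under \<open>A\<close>, and it is nonzero while fewer than \<open>CARD('n)\<close>
  have been found.\<close>

lemma symmetric_orthonormal_eigenvectors:
  fixes A :: "real^'n^'n"
  assumes sym: "transpose A = A"
  shows "n \<le> CARD('n) \<Longrightarrow> \<exists>B. finite B \<and> card B = n \<and> pairwise orthogonal B \<and>
    (\<forall>b\<in>B. norm b = 1 \<and> (\<exists>\<mu>. A *v b = \<mu> *\<^sub>R b))"
proof (induction n)
  case 0
  show ?case by (rule exI[of _ "{}"]) simp
next
  case (Suc n)
  then obtain B where B: "finite B" "card B = n" "pairwise orthogonal B"
    "\<And>b. b \<in> B \<Longrightarrow> norm b = 1" "\<And>b. b \<in> B \<Longrightarrow> \<exists>\<mu>. A *v b = \<mu> *\<^sub>R b"
    by auto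
  define S where "S = {x. \<forall>b\<in>B. b \<bullet> x = 0}"
  have S: "subspace S"
    by (auto simp: subspace_def S_def inner_add_right)
  have "dim B < DIM(real^'n)"
    using dim_le_card'[OF B(1)] B(2) Suc.prems by simp
  then obtain x0 where "x0 \<noteq> 0" "\<And>y. y \<in> span B \<Longrightarrow> orthogonal x0 y"
    using orthogonal_to_subspace_exists by blast
  then have x0: "x0 \<in> S" "x0 \<noteq> 0"
    by (auto simp: S_def orthogonal_def inner_commute span_base)
  have "A *v x \<in> S" if "x \<in> S" for x
    using that B(5) symmetric_matrix_dot[OF sym] by (fastforce simp: S_def)
  then obtain x \<mu> where x: "x \<in> S" "norm x = 1" "A *v x = \<mu> *\<^sub>R x"
    using symmetric_eigenvector_in_subspace[OF sym S _ x0] by metis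
  have "x \<notin> B"
    using x by (auto simp: S_def)
  moreover have "pairwise orthogonal (insert x B)"
    using x B(3) by (auto simp: pairwise_insert S_def orthogonal_def inner_commute)
  ultimately show ?case
    using B x by (intro exI[of _ "insert x B"]) auto
qed

lemma symmetric_eigenbasis:
  fixes A :: "real^'n^'n"
  assumes "transpose A = A"
  obtains h :: "'n \<Rightarrow> real^'n" and \<mu> :: "'n \<Rightarrow> real"
  where "\<And>i j. h i \<bullet> h j = (if i = j then 1 else 0)" "\<And>i. A *v h i = \<mu> i *\<^sub>R h i"
proof -
  obtain B where B: "finite B" "card B = CARD('n)" "pairwise orthogonal B"
    "\<And>b. b \<in> B \<Longrightarrow> norm b = 1" "\<And>b. b \<in> B \<Longrightarrow> \<exists>\<mu>. A *v b = \<mu> *\<^sub>R b"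
    using symmetric_orthonormal_eigenvectors[OF assms, of "CARD('n)"] by auto
  obtain h :: "'n \<Rightarrow> real^'n" where h: "bij_betw h UNIV B"
    using B finite_same_card_bij[of "UNIV :: 'n set" B] by auto
  have hB: "h i \<in> B" for i
    using h by (auto simp: bij_betw_def)
  obtain \<mu> where "\<And>i. A *v h i = \<mu> i *\<^sub>R h i"
    using B(5)[OF hB] by metis
  moreover have "h i \<bullet> h j = (if i = j then 1 else 0)" for i j
  proof (cases "i = j")
    case False
    then have "h i \<noteq> h j"
      using h by (auto simp: bij_betw_def inj_def)
    then show ?thesis
      using False B(3) hB by (auto simp: pairwise_def orthogonal_def)
  qed (use B(4) hB in \<open>simp add: dot_square_norm\<close>)
  ultimately show thesis
    using that by blast
qed

section \<open>Coordinates with respect to an orthonormal eigenbasis\<close>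

locale orthonormal_family =
  fixes h :: "'n::finite \<Rightarrow> real^'n"
  assumes orthonormal: "h i \<bullet> h j = (if i = j then 1 else 0)"
begin

lemma inj_family: "inj h"
  by (metis (mono_tags, lifting) injI orthonormal zero_neq_one)

lemma independent_image: "independent (h ` K)"
proof (rule pairwise_orthogonal_independent)
  show "pairwise orthogonal (h ` K)"
    by (auto simp: pairwise_def orthogonal_def orthonormal)
  show "0 \<notin> h ` K"
    using orthonormal by (metis imageE inner_zero_left zero_neq_one)
qed

lemma dim_span_image: "dim (span (h ` K)) = card K"
  by (metis dim_span dim_eq_card_independent independent_image card_image inj_family inj_on_subset
      subset_UNIV)

lemma expansion: "x = (\<Sum>k\<in>UNIV. (h k \<bullet> x) *\<^sub>R h k)"
proof -
  define y where "y = x - (\<Sum>k\<in>UNIV. (h k \<bullet> x) *\<^sub>R h k)"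
  \<comment> \<open>The index type is also the coordinate type, so the family has full cardinality
    and spans. The remainder y is orthogonal to every member, hence to itself.\<close>
  have "dim (span (range h)) = dim (UNIV :: (real^'n) set)"
    by (simp add: dim_span_image del: dim_span)
  then have "span (range h) = UNIV"
    by (metis dim_eq_full dim_span span_span dim_UNIV)
  moreover have "orthogonal y z" if "z \<in> range h" for z
    using that by (auto simp: y_def orthogonal_def inner_diff_left inner_sum_left orthonormal
        inner_commute[of x] if_distrib cong: if_cong)
  ultimately have "orthogonal y y"
    using orthogonal_to_span by blast
  then show ?thesis
    by (simp add: y_def orthogonal_def)
qed

lemma dot_expansion: "x \<bullet> y = (\<Sum>k\<in>UNIV. (h k \<bullet> x) * (h k \<bullet> y))"
  by (subst expansion[of x]) (simp add: inner_sum_left)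

lemma dot_outside_span:
  assumes "x \<in> span (h ` K)" "k \<notin> K"
  shows "h k \<bullet> x = 0"
proof -
  have "orthogonal (h k) x"
    by (rule orthogonal_to_span[OF assms(1)]) (use assms(2) in \<open>auto simp: orthogonal_def orthonormal\<close>)
  then show ?thesis
    by (simp add: orthogonal_def)
qed

end

locale orthonormal_eigenbasis = orthonormal_family h for h :: "'n::finite \<Rightarrow> real^'n" +
  fixes A :: "real^'n^'n" and \<mu> :: "'n \<Rightarrow> real"
  assumes sym: "transpose A = A" and eigen: "A *v h i = \<mu> i *\<^sub>R h i"
begin

lemma quadratic_form: "x \<bullet> (A *v x) = (\<Sum>k\<in>UNIV. \<mu> k * (h k \<bullet> x)\<^sup>2)"
proof -
  have "h k \<bullet> (A *v x) = \<mu> k * (h k \<bullet> x)" for k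
    by (simp add: symmetric_matrix_dot[OF sym] eigen)
  then show ?thesis
    by (simp add: dot_expansion[of x] power2_eq_square mult_ac)
qed

lemma quadratic_form_ge:
  assumes "x \<in> span (h ` K)" "\<And>k. k \<in> K \<Longrightarrow> c \<le> \<mu> k"
  shows "c * (x \<bullet> x) \<le> x \<bullet> (A *v x)"
proof -
  have "c * (h k \<bullet> x)\<^sup>2 \<le> \<mu> k * (h k \<bullet> x)\<^sup>2" for k
    using assms dot_outside_span by (cases "k \<in> K") (auto intro: mult_right_mono)
  then show ?thesis
    unfolding quadratic_form dot_expansion[of x x] sum_distrib_left
    by (intro sum_mono) (simp add: power2_eq_square)
qed

lemma quadratic_form_le:
  assumes "x \<in> span (h ` K)" "\<And>k. k \<in> K \<Longrightarrow> \<mu> k \<le> c"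
  shows "x \<bullet> (A *v x) \<le> c * (x \<bullet> x)"
proof -
  have "\<mu> k * (h k \<bullet> x)\<^sup>2 \<le> c * (h k \<bullet> x)\<^sup>2" for k
    using assms dot_outside_span by (cases "k \<in> K") (auto intro: mult_right_mono)
  then show ?thesis
    unfolding quadratic_form dot_expansion[of x x] sum_distrib_left
    by (intro sum_mono) (simp add: power2_eq_square)
qed

end

section \<open>Eigenvalues as roots of the characteristic polynomial\<close>

lemma poly_char_poly_mat: "poly (char_poly_mat A) t = det (t *\<^sub>R mat 1 - A)"
  unfolding char_poly_mat_def det_def
  by (auto simp: poly_sum poly_prod mat_def intro!: sum.cong prod.cong)

context orthonormal_eigenbasis
begin

text \<open>With the eigenvectors as columns of \<open>Q\<close>, the matrix tI - A is conjugate to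
  the diagonal matrix \<open>D t\<close> for every real t. Two real polynomials that agree at all
  reals are equal.\<close>

lemma char_poly_mat_eq: "char_poly_mat A = (\<Prod>k\<in>UNIV. [:- \<mu> k, 1:])"
proof -
  define Q where "Q = transpose (\<chi> k. h k)"
  define D where "D t = (\<chi> i j. if i = j then t - \<mu> i else 0)" for t
  have "transpose Q ** Q = mat 1"
    unfolding Q_def vec_eq_iff
    using orthonormal by (simp add: matrix_matrix_mult_def transpose_def mat_def inner_vec_def)
  then have "det Q \<noteq> 0"
    using det_mul[of "transpose Q" Q] by auto
  have "(t *\<^sub>R mat 1 - A) ** Q = Q ** D t" for t
  proof -
    have "((t *\<^sub>R mat 1 - A) ** Q) $ i $ j = (Q ** D t) $ i $ j" for i j
    proof -
      have "((t *\<^sub>R mat 1 - A) ** Q) $ i $ j = ((t *\<^sub>R mat 1 - A) *v h j) $ i"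
        by (simp add: matrix_matrix_mult_def matrix_vector_mult_def Q_def transpose_def)
      also have "\<dots> = (t - \<mu> j) * h j $ i"
        using eigen[of j]
        by (simp add: matrix_vector_mult_diff_rdistrib scaleR_matrix_vector_assoc[symmetric] algebra_simps)
      also have "\<dots> = (Q ** D t) $ i $ j"
        by (simp add: matrix_matrix_mult_def Q_def D_def transpose_def if_distrib cong: if_cong)
      finally show ?thesis .
    qed
    then show ?thesis by (simp add: vec_eq_iff)
  qed
  then have "det (t *\<^sub>R mat 1 - A) * det Q = det Q * det (D t)" for t
    by (metis det_mul)
  then have "det (t *\<^sub>R mat 1 - A) = det (D t)" for t
    using \<open>det Q \<noteq> 0\<close> by simp
  moreover have "det (D t) = (\<Prod>k\<in>UNIV. t - \<mu> k)" for t
    by (subst det_diagonal) (auto simp: D_def)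
  ultimately have "poly (char_poly_mat A) = poly (\<Prod>k\<in>UNIV. [:- \<mu> k, 1:])"
    by (simp add: fun_eq_iff poly_char_poly_mat poly_prod)
  then show ?thesis
    by (simp add: poly_eq_poly_eq_iff)
qed

lemma proots_char_poly_mat: "proots (char_poly_mat A) = image_mset \<mu> (mset_set UNIV)"
  unfolding char_poly_mat_eq
  by (subst proots_prod) (auto simp: sum_unfold_sum_mset)

text \<open>This translates positions in the sorted list of roots into numbers of basis vectors.
  Both estimates are inequalities because eigenvalues may repeat; the first one is written
  additively to avoid truncated subtraction.\<close>

lemma card_eigenvalues:
  fixes i :: nat
  assumes "1 \<le> i" "i \<le> CARD('n)"
  shows "CARD('n) + 1 \<le> i + card {k. nth_eigenvalue i A \<le> \<mu> k}"
    and "i \<le> card {k. \<mu> k \<le> nth_eigenvalue i A}"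
proof -
  define xs where "xs = sorted_list_of_multiset (proots (char_poly_mat A))"
  have xs: "sorted xs" "mset xs = image_mset \<mu> (mset_set UNIV)"
    by (simp_all add: xs_def proots_char_poly_mat)
  have len: "length xs = CARD('n)"
    by (metis xs(2) size_mset size_image_mset size_mset_set)
  have count: "card {k. P (\<mu> k)} = card {j. j < length xs \<and> P (xs ! j)}" for P
  proof -
    have "card {k. P (\<mu> k)} = size (filter_mset P (mset xs))"
      by (simp add: xs(2) filter_mset_image_mset)
    also have "\<dots> = length (filter P xs)"
      by (metis mset_filter size_mset)
    finally show ?thesis
      by (simp add: length_filter_conv_card)
  qed
  have nth: "nth_eigenvalue i A = xs ! (i - 1)"
    by (simp add: nth_eigenvalue_def xs_def)
  \<comment> \<open>The list is indexed from 0, so the i-th smallest eigenvalue sits at position i -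
    1 and CARD('n) - i + 1 positions start from there.\<close>
  have "card {i - 1..<CARD('n)} \<le> card {j. j < length xs \<and> nth_eigenvalue i A \<le> xs ! j}"
    using xs(1) len by (intro card_mono) (auto simp: nth sorted_iff_nth_mono)
  then show "CARD('n) + 1 \<le> i + card {k. nth_eigenvalue i A \<le> \<mu> k}"
    using assms by (simp add: count[of "\<lambda>x. nth_eigenvalue i A \<le> x"])
  have "card {..<i} \<le> card {j. j < length xs \<and> xs ! j \<le> nth_eigenvalue i A}"
    using xs(1) len assms by (intro card_mono) (auto simp: nth sorted_iff_nth_mono)
  then show "i \<le> card {k. \<mu> k \<le> nth_eigenvalue i A}"
    by (simp add: count[of "\<lambda>x. x \<le> nth_eigenvalue i A"])
qed

end

section \<open>The two halves of the min-max principle\<close>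

lemma subspaces_meet_nontrivially:
  fixes S T :: "'a::euclidean_space set"
  assumes "subspace S" "subspace T" "DIM('a) < dim S + dim T"
  obtains x where "x \<in> S" "x \<in> T" "x \<noteq> 0"
proof -
  have "dim (S \<inter> T) \<noteq> 0"
    using dim_sums_Int[OF assms(1,2)] dim_subset_UNIV[of "{x + y |x y. x \<in> S \<and> y \<in> T}"] assms(3)
    by linarith
  then show thesis
    using that unfolding dim_eq_0 by blast
qed

text \<open>The eigenvectors whose eigenvalue is at least the i-th span a space of dimension at
  least n - i + 1, which must meet \<open>W\<close> outside 0. At a common vector both bounds on the
  form apply.\<close>

lemma nth_eigenvalue_le:
  fixes A :: "real^'n^'n"
  assumes sym: "transpose A = A" and W: "subspace W" "i \<le> dim W" and "1 \<le> i"
    and bound: "\<And>x. x \<in> W \<Longrightarrow> x \<bullet> (A *v x) \<le> c * (x \<bullet> x)"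
  shows "nth_eigenvalue i A \<le> c"
proof -
  obtain h :: "'n \<Rightarrow> real^'n" and \<mu>
    where "\<And>i j. h i \<bullet> h j = (if i = j then 1 else 0)" "\<And>i. A *v h i = \<mu> i *\<^sub>R h i"
    using symmetric_eigenbasis[OF sym] by blast
  then interpret orthonormal_eigenbasis h A \<mu>
    by unfold_locales (use sym in auto)
  define K where "K = {k. nth_eigenvalue i A \<le> \<mu> k}"
  have "i \<le> CARD('n)"
    using dim_subset_UNIV[of W] W(2) by simp
  then have "DIM(real^'n) < dim W + dim (span (h ` K))"
    using card_eigenvalues(1)[of i] \<open>1 \<le> i\<close> W unfolding dim_span_image K_def by simp
  then obtain x where x: "x \<in> W" "x \<in> span (h ` K)" "x \<noteq> 0"
    using subspaces_meet_nontrivially[OF W(1) subspace_span] by blast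
  have "nth_eigenvalue i A * (x \<bullet> x) \<le> c * (x \<bullet> x)"
    using quadratic_form_ge[OF x(2), of "nth_eigenvalue i A"] bound[OF x(1)] by (auto simp: K_def)
  then show ?thesis
    using x(3) by simp
qed

text \<open>The witness is the span of the eigenvectors with eigenvalue at most the i-th. This half
  extracts a test vector from the Laplacian; the previous one bounds eigenvalues of the stiffness
  matrix.\<close>

lemma nth_eigenvalue_subspace:
  fixes A :: "real^'n^'n"
  assumes sym: "transpose A = A" and "1 \<le> i" "i \<le> CARD('n)"
  obtains W where "subspace W" "i \<le> dim W"
    "\<And>x. x \<in> W \<Longrightarrow> x \<bullet> (A *v x) \<le> nth_eigenvalue i A * (x \<bullet> x)"
proof -
  obtain h :: "'n \<Rightarrow> real^'n" and \<mu>
    where "\<And>i j. h i \<bullet> h j = (if i = j then 1 else 0)" "\<And>i. A *v h i = \<mu> i *\<^sub>R h i"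
    using symmetric_eigenbasis[OF sym] by blast
  then interpret orthonormal_eigenbasis h A \<mu>
    by unfold_locales (use sym in auto)
  define K where "K = {k. \<mu> k \<le> nth_eigenvalue i A}"
  show thesis
  proof (rule that)
    show "i \<le> dim (span (h ` K))"
      using card_eigenvalues(2)[OF assms(2,3)] unfolding dim_span_image K_def .
    show "x \<bullet> (A *v x) \<le> nth_eigenvalue i A * (x \<bullet> x)" if "x \<in> span (h ` K)" for x
      using quadratic_form_le[OF that] by (auto simp: K_def)
  qed (rule subspace_span)
qed

section \<open>Quadratic forms of graph matrices\<close>

lemma transpose_stiffness_matrix: "transpose (stiffness_matrix E p) = stiffness_matrix E p"
  by (simp add: stiffness_matrix_def matrix_transpose_mul)

lemma stiffness_matrix_form:
  "x \<bullet> (stiffness_matrix E p *v x) = (\<Sum>e\<in>E. (edge_column p e \<bullet> x)\<^sup>2)"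
proof -
  let ?R = "rigidity_matrix E p"
  have comp: "(x v* ?R) $ e = (if e \<in> E then edge_column p e \<bullet> x else 0)" for e
    by (simp add: vector_matrix_mult_def rigidity_matrix_def inner_vec_def mult.commute)
  have "x \<bullet> (stiffness_matrix E p *v x) = (x v* ?R) \<bullet> (x v* ?R)"
    by (simp add: stiffness_matrix_def matrix_vector_mul_assoc[symmetric] dot_lmul_matrix)
  also have "\<dots> = (\<Sum>e\<in>UNIV. if e \<in> E then (edge_column p e \<bullet> x)\<^sup>2 else 0)"
    by (subst inner_vec_def) (auto simp: comp power2_eq_square intro: sum.cong)
  also have "\<dots> = (\<Sum>e\<in>E. (edge_column p e \<bullet> x)\<^sup>2)"
    by (simp add: sum.If_cases)
  finally show ?thesis .
qed

text \<open>Identifies velocity fields on the vertices with vectors of the space on which the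
  stiffness matrix acts, with the index order of \<open>kron_vec\<close>.\<close>

definition stack :: "('v::finite \<Rightarrow> real^'d::finite) \<Rightarrow> real^('v \<times> 'd)" where
  "stack g = (\<chi> k. g (fst k) $ snd k)"

lemma stack_dot: "stack g \<bullet> stack h = (\<Sum>u\<in>UNIV. g u \<bullet> h u)"
  by (simp add: stack_def inner_vec_def sum.cartesian_product UNIV_Times_UNIV[symmetric]
      case_prod_unfold del: UNIV_Times_UNIV)

lemma stack_eq_0_iff: "stack g = 0 \<longleftrightarrow> (\<forall>u. g u = 0)"
  by (simp add: stack_def vec_eq_iff)

text \<open>The pairing is the relative velocity of the endpoints along the edge; this is why
  infinitesimal rigid motions lie in the kernel of the stiffness matrix.\<close>

lemma edge_column_dot_stack:
  assumes "u \<noteq> v"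
  shows "edge_column p {u, v} \<bullet> stack g = edge_dir p u v \<bullet> (g u - g v)"
proof -
  have "kron_vec a b = stack (\<lambda>u. a $ u *\<^sub>R b)" for a :: "real^'a" and b :: "real^'b"
    by (simp add: kron_vec_def stack_def)
  then have "edge_column p {u, v} \<bullet> stack g
      = (\<Sum>w\<in>UNIV. (axis u 1 - axis v 1 :: real^'a) $ w * (edge_dir p u v \<bullet> g w))"
    by (simp add: edge_column_doubleton[OF assms] stack_dot)
  also have "\<dots> = edge_dir p u v \<bullet> (g u - g v)"
    by (simp add: axis_def left_diff_distrib sum_subtractf if_distribR inner_diff_right
        if_distrib[of "\<lambda>x. x * _"] cong: if_cong)
  finally show ?thesis .
qed

lemma laplacian_form:
  assumes "\<And>e. e \<in> E \<Longrightarrow> s e \<noteq> t e \<and> e = {s e, t e}"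
  shows "f \<bullet> (laplacian E *v f) = (\<Sum>e\<in>E. (f $ s e - f $ t e)\<^sup>2)"
proof -
  define b :: "'a set \<Rightarrow> real^'a" where "b e = axis (s e) 1 - axis (t e) 1" for e
  \<comment> \<open>The Laplacian is the sum of the rank-one matrices of the vectors b e. The
    orientation by s and t cancels in each product.\<close>
  have entry: "laplacian E $ u $ v = (\<Sum>e\<in>E. b e $ u * b e $ v)" for u v
  proof (cases "u = v")
    case True
    have "b e $ u * b e $ u = (if u \<in> e then 1 else 0)" if "e \<in> E" for e
    proof -
      have "u \<in> e \<longleftrightarrow> u = s e \<or> u = t e"
        using assms[OF that] by blast
      then show ?thesis
        using assms[OF that] by (auto simp: b_def axis_def)
    qed
    then have "(\<Sum>e\<in>E. b e $ u * b e $ u) = (\<Sum>e\<in>E. if u \<in> e then 1 else 0)"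
      by (intro sum.cong) auto
    also have "\<dots> = real (card {e \<in> E. u \<in> e})"
      by (simp add: sum.If_cases Int_def)
    finally show ?thesis
      using True by (simp add: laplacian_def)
  next
    case False
    have "b e $ u * b e $ v = (if e = {u, v} then - 1 else 0)" if "e \<in> E" for e
    proof -
      have "e = {u, v} \<longleftrightarrow> u = s e \<and> v = t e \<or> u = t e \<and> v = s e"
        using assms[OF that] by (metis doubleton_eq_iff)
      then show ?thesis
        using False assms[OF that] by (auto simp: b_def axis_def)
    qed
    then have "(\<Sum>e\<in>E. b e $ u * b e $ v) = (\<Sum>e\<in>E. if e = {u, v} then - 1 else 0)"
      by (intro sum.cong) auto
    also have "\<dots> = (if {u, v} \<in> E then - 1 else 0)"
      by simp
    finally show ?thesis
      using False by (simp add: laplacian_def)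
  qed
  have "f \<bullet> (laplacian E *v f) = (\<Sum>u\<in>UNIV. \<Sum>v\<in>UNIV. \<Sum>e\<in>E. (b e $ u * f $ u) * (b e $ v * f $ v))"
    by (simp add: inner_vec_def matrix_vector_mult_def entry sum_distrib_left sum_distrib_right mult_ac)
  also have "\<dots> = (\<Sum>u\<in>UNIV. \<Sum>e\<in>E. \<Sum>v\<in>UNIV. (b e $ u * f $ u) * (b e $ v * f $ v))"
    by (intro sum.cong refl sum.swap)
  also have "\<dots> = (\<Sum>e\<in>E. \<Sum>u\<in>UNIV. \<Sum>v\<in>UNIV. (b e $ u * f $ u) * (b e $ v * f $ v))"
    by (rule sum.swap)
  also have "\<dots> = (\<Sum>e\<in>E. (b e \<bullet> f)\<^sup>2)"
    by (simp add: inner_vec_def power2_eq_square sum_product)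
  also have "\<dots> = (\<Sum>e\<in>E. (f $ s e - f $ t e)\<^sup>2)"
    by (simp add: b_def inner_diff_left inner_axis')
  finally show ?thesis .
qed

lemma simple_graph_endpoints:
  assumes "simple_graph E"
  obtains s t where "\<And>e. e \<in> E \<Longrightarrow> s e \<noteq> t e \<and> e = {s e, t e}"
proof -
  have "\<forall>e\<in>E. \<exists>u v. u \<noteq> v \<and> e = {u, v}"
    using assms unfolding simple_graph_def card_2_iff by blast
  then show thesis
    using that by metis
qed

lemma laplacian_form_nonneg:
  assumes "simple_graph E"
  shows "0 \<le> f \<bullet> (laplacian E *v f)"
proof -
  obtain s t where "\<And>e. e \<in> E \<Longrightarrow> s e \<noteq> t e \<and> e = {s e, t e}"
    using simple_graph_endpoints[OF assms] by blast
  from laplacian_form[OF this] show ?thesis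
    by (simp add: sum_nonneg)
qed

lemma transpose_laplacian: "transpose (laplacian E) = laplacian E"
  by (simp add: transpose_def laplacian_def vec_eq_iff insert_commute)

text \<open>A space of dimension at least 2 on which the form is bounded by the second eigenvalue
  meets the hyperplane orthogonal to the constants outside 0.\<close>

lemma algebraic_connectivity_test_vector:
  fixes E :: "'v::finite set set"
  assumes "2 \<le> CARD('v)"
  obtains f :: "real^'v" where "norm f = 1" "(\<Sum>u\<in>UNIV. f $ u) = 0"
    "f \<bullet> (laplacian E *v f) \<le> algebraic_connectivity E"
proof -
  obtain W where W: "subspace W" "2 \<le> dim W"
    "\<And>x. x \<in> W \<Longrightarrow> x \<bullet> (laplacian E *v x) \<le> algebraic_connectivity E * (x \<bullet> x)"
    unfolding algebraic_connectivity_def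
    using nth_eigenvalue_subspace[OF transpose_laplacian, of 2] assms by auto
  let ?one = "(\<chi> u. 1) :: real^'v"
  have "?one \<noteq> 0"
    by (simp add: vec_eq_iff)
  then have "dim {x. ?one \<bullet> x = 0} = CARD('v) - 1"
    by (simp add: dim_hyperplane)
  then have "DIM(real^'v) < dim W + dim {x. ?one \<bullet> x = 0}"
    using W(2) assms by simp
  then obtain x where x: "x \<in> W" "?one \<bullet> x = 0" "x \<noteq> 0"
    using subspaces_meet_nontrivially[OF W(1) subspace_hyperplane[of ?one]] by blast
  define f where "f = (1 / norm x) *\<^sub>R x"
  have f: "f \<in> W" "norm f = 1"
    using x W(1) by (simp_all add: f_def subspace_scale)
  have "(\<Sum>u\<in>UNIV. f $ u) = (?one \<bullet> x) / norm x"
    by (simp add: f_def inner_vec_def sum_divide_distrib)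
  then show thesis
    using that[of f] f W(3)[OF f(1)] x(2) by (simp add: dot_square_norm)
qed

section \<open>Skew-symmetric matrices\<close>

lemma dim_skew_symmetric:
  "CARD('d::finite) choose 2 \<le> dim {A :: real^'d^'d. transpose A = - A}"
proof -
  \<comment> \<open>These are the standard symmetric matrices: M {a} is a diagonal unit and M {a, b}
    is E_ab + E_ba. There are at most d + (d choose 2) of them, and a matrix orthogonal to all is
    skew-symmetric, which leaves dimension at least d^2 - d - (d choose 2) = (d choose 2).\<close>
  define M :: "'d set \<Rightarrow> real^'d^'d" where "M s = (\<chi> a b. if {a, b} = s then 1 else 0)" for s
  define C where "C = M ` ({s. card s = 1} \<union> {s. card s = 2})"
  have "card C \<le> card ({s :: 'd set. card s = 1} \<union> {s. card s = 2})"
    unfolding C_def by (rule card_image_le) simp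
  also have "\<dots> \<le> card {s :: 'd set. card s = 1} + card {s :: 'd set. card s = 2}"
    by (rule card_Un_le)
  also have "\<dots> = CARD('d) + (CARD('d) choose 2)"
    using n_subsets[of "UNIV :: 'd set" 1] n_subsets[of "UNIV :: 'd set" 2] by simp
  finally have "dim (span C) \<le> CARD('d) + (CARD('d) choose 2)"
    using dim_le_card'[of C] by (simp add: C_def)
  moreover have "dim {y. \<forall>x\<in>span C. orthogonal x y} + dim (span C) = CARD('d) * CARD('d)"
    using dim_subspace_orthogonal_to_vectors[of "span C" UNIV] by simp
  moreover have "2 * (CARD('d) choose 2) + CARD('d) = CARD('d) * CARD('d)"
    by (cases "CARD('d)") (simp_all add: choose_two)
  moreover have "dim {y. \<forall>x\<in>span C. orthogonal x y} \<le> dim {A :: real^'d^'d. transpose A = - A}"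
  proof (rule dim_subset, clarify)
    fix Y assume Y: "\<forall>x\<in>span C. orthogonal x Y"
    have "transpose Y $ a $ b = (- Y) $ a $ b" for a b
    proof -
      have "M {a, b} \<in> C"
        by (cases "a = b") (auto simp: C_def)
      then have "M {a, b} \<bullet> Y = 0"
        using Y by (simp add: orthogonal_def span_base)
      moreover have "M {a, b} \<bullet> Y = (if a = b then Y $ a $ a else Y $ a $ b + Y $ b $ a)"
      proof (cases "a = b")
        case True
        have "M {a, a} = axis a (axis a 1)"
          by (auto simp: M_def vec_eq_iff axis_def)
        then show ?thesis
          using True by (simp add: inner_axis')
      next
        case False
        have "M {a, b} = axis a (axis b 1) + axis b (axis a 1)"
          using False by (auto simp: M_def vec_eq_iff axis_def doubleton_eq_iff)
        then show ?thesis
          using False by (simp add: inner_axis' inner_add_left)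
      qed
      ultimately show ?thesis
        by (auto simp: transpose_def split: if_splits)
    qed
    then show "transpose Y = - Y"
      by (simp only: vec_eq_iff) blast
  qed
  ultimately show ?thesis
    by linarith
qed

lemma skew_symmetric_dot:
  fixes A :: "real^'d^'d"
  assumes "transpose A = - A"
  shows "x \<bullet> (A *v x) = 0"
proof -
  have "x \<bullet> (A *v x) = (transpose A *v x) \<bullet> x"
    by (simp add: dot_lmul_matrix)
  also have "\<dots> = - (x \<bullet> (A *v x))"
    unfolding assms using matrix_vector_mult_diff_rdistrib[of 0 A x] by (simp add: inner_commute)
  finally show ?thesis by simp
qed

lemma subspace_skew_symmetric: "subspace {A :: real^'d^'d. transpose A = - A}"
proof -
  have "transpose (A + B) = transpose A + transpose B" "transpose 0 = (0 :: real^'d^'d)"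
    for A B :: "real^'d^'d"
    by (simp_all add: transpose_def vec_eq_iff)
  then show ?thesis
    by (simp add: subspace_def transpose_scalar)
qed

section \<open>Test spaces and perturbation\<close>

text \<open>Coinciding endpoints give the zero vector here too, so the direction is always a scalar
  multiple of the difference.\<close>

lemma edge_dir_eq: "edge_dir p u v = (1 / norm (p u - p v)) *\<^sub>R (p u - p v)"
  by (simp add: edge_dir_def)

lemma norm_edge_dir_le: "norm (edge_dir p u v) \<le> 1"
  by (simp add: edge_dir_def)

lemma skew_orthogonal_direction:
  fixes q :: "real^'d"
  obtains w where "norm w = 1" "\<And>A. transpose A = - A \<Longrightarrow> w \<bullet> (A *v q) = 0"
proof (cases "q = 0")
  case True
  obtain w :: "real^'d" where "norm w = 1"
    using vector_choose_size[of 1] by auto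
  then show thesis
    using that True by simp
next
  case False
  show thesis
    by (rule that[of "(1 / norm q) *\<^sub>R q"]) (use False in \<open>simp_all add: skew_symmetric_dot\<close>)
qed

text \<open>Linear spanning of the points already makes the map from pairs (A, b) to motions
  injective, so d suitably placed points are enough.\<close>

lemma stiffness_matrix_test_space:
  fixes E :: "'v::finite set set" and p :: "'v \<Rightarrow> real^'d" and f :: "real^'v"
  assumes E: "simple_graph E" and p: "span (range p) = UNIV"
    and f: "norm f = 1" "(\<Sum>u\<in>UNIV. f $ u) = 0" "f \<bullet> (laplacian E *v f) \<le> a"
  obtains W where "subspace W" "((CARD('d) + 1) choose 2) + 1 \<le> dim W"
    "\<And>x. x \<in> W \<Longrightarrow> x \<bullet> (stiffness_matrix E p *v x) \<le> a * (x \<bullet> x)"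
proof -
  define skew where "skew = {A :: real^'d^'d. transpose A = - A}"
  define q where "q = (\<Sum>u\<in>UNIV. f $ u *\<^sub>R p u)"
  obtain w where w: "norm w = 1" "\<And>A. transpose A = - A \<Longrightarrow> w \<bullet> (A *v q) = 0"
    using skew_orthogonal_direction[of q] by blast
  define z where "z = stack (\<lambda>u. f $ u *\<^sub>R w)"
  define m where "m A b = stack (\<lambda>u. A *v p u + b)" for A :: "real^'d^'d" and b
  \<comment> \<open>Parametrising the test space linearly lets its dimension be read off the domain
    \<open>X\<close> once injectivity on \<open>X\<close> is known.\<close>
  define \<Psi> where "\<Psi> = (\<lambda>((A, b), c). m A b + c *\<^sub>R z)"
  define X where "X = (skew \<times> (UNIV :: (real^'d) set)) \<times> (UNIV :: real set)"
  have "f \<bullet> f = 1" "w \<bullet> w = 1"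
    using f(1) w(1) by (simp_all add: norm_eq_1)
  then have zz: "z \<bullet> z = 1"
    by (simp add: z_def stack_dot inner_vec_def[of f])
  have zm: "z \<bullet> m A b = 0" if "A \<in> skew" for A b
  proof -
    have "z \<bullet> m A b = (\<Sum>u\<in>UNIV. f $ u * (w \<bullet> (A *v p u))) + (\<Sum>u\<in>UNIV. f $ u) * (w \<bullet> b)"
      by (simp add: z_def m_def stack_dot inner_add_right distrib_left sum.distrib sum_distrib_right)
    also have "(\<Sum>u\<in>UNIV. f $ u * (w \<bullet> (A *v p u))) = w \<bullet> (A *v q)"
      by (simp add: q_def linear_sum[OF matrix_vector_mul_linear] inner_sum_right
          matrix_vector_mult_scaleR)
    finally show ?thesis
      using w(2) that f(2) by (simp add: skew_def)
  qed
  \<comment> \<open>Pythagoras serves twice: it separates the components when \<open>\<Psi>\<close>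
    vanishes, and it shows that adding a trivial motion can only lengthen the test vector.\<close>
  have norm_sq: "(m A b + c *\<^sub>R z) \<bullet> (m A b + c *\<^sub>R z) = m A b \<bullet> m A b + c\<^sup>2" if "A \<in> skew" for A b c
    using zm[OF that, of b] zz
    by (simp add: inner_add_left inner_add_right inner_commute power2_eq_square)
  have "linear \<Psi>"
    by (rule linearI)
       (auto simp: \<Psi>_def m_def z_def stack_def vec_eq_iff algebra_simps
          scaleR_matrix_vector_assoc[symmetric])
  have X: "subspace X"
    unfolding X_def skew_def by (intro subspace_Times subspace_skew_symmetric subspace_UNIV)
  have "x = 0" if "x \<in> X" "\<Psi> x = 0" for x
  proof -
    obtain A b c where x: "x = ((A, b), c)" by (metis surj_pair)
    have A: "A \<in> skew" using that x by (simp add: X_def)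
    have "m A b \<bullet> m A b + c\<^sup>2 = 0"
      using norm_sq[OF A, of b c] that(2) by (simp add: \<Psi>_def x)
    then have c: "c = 0" and mz: "m A b = 0"
      using inner_ge_zero[of "m A b"] by (smt (verit) zero_le_power2 power2_eq_iff inner_eq_zero_iff zero_eq_power2)+
    then have motion: "A *v p u + b = 0" for u
      by (simp add: m_def stack_eq_0_iff)
    \<comment> \<open>Pairing the vanishing motion with the position itself eliminates the skew part.\<close>
    have "orthogonal b y" if "y \<in> range p" for y
    proof -
      have "y \<bullet> (A *v y + b) = 0" using that motion by auto
      then show ?thesis
        using A by (simp add: orthogonal_def inner_add_right skew_symmetric_dot skew_def inner_commute)
    qed
    then have "orthogonal b b"
      using orthogonal_to_span[of b "range p" b] p by blast
    then have b: "b = 0" by (simp add: orthogonal_def)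
    have "A *v y = 0" for y
      by (rule linear_eq_0_on_span[OF matrix_vector_mul_linear, of "range p"])
         (use motion b p in auto)
    then have "A = 0" by (simp add: matrix_eq)
    with b c x show ?thesis by (simp add: zero_prod_def)
  qed
  then have "inj_on \<Psi> X"
    using linear_injective_on_subspace_0[OF \<open>linear \<Psi>\<close> X] by blast
  moreover have "span X = X"
    using X by simp
  ultimately have "dim (\<Psi> ` X) = dim X"
    using dim_image_eq[OF \<open>linear \<Psi>\<close>, of X] by metis
  also have "dim X = dim skew + CARD('d) + 1"
    by (simp add: X_def skew_def dim_Times subspace_Times subspace_skew_symmetric)
  \<comment> \<open>By Pascal's rule, (d + 1) choose 2 equals (d choose 2) + d; the extra 1 is the
    direction z.\<close>
  finally have "((CARD('d) + 1) choose 2) + 1 \<le> dim (\<Psi> ` X)"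
    using dim_skew_symmetric[where 'd='d] by (simp add: skew_def numeral_2_eq_2)
  moreover have "x \<bullet> (stiffness_matrix E p *v x) \<le> a * (x \<bullet> x)" if xX: "x \<in> \<Psi> ` X" for x
  proof -
    obtain A b c where A: "A \<in> skew" and x: "x = m A b + c *\<^sub>R z"
      using xX by (auto simp: X_def \<Psi>_def)
    obtain s t where st: "\<And>e. e \<in> E \<Longrightarrow> s e \<noteq> t e \<and> e = {s e, t e}"
      using simple_graph_endpoints[OF E] by blast
    have col: "(edge_column p e \<bullet> x)\<^sup>2 \<le> c\<^sup>2 * (f $ s e - f $ t e)\<^sup>2" if "e \<in> E" for e
    proof -
      let ?d = "edge_dir p (s e) (t e)"
      have ne: "s e \<noteq> t e"
        using st[OF that] by blast
      have e: "edge_column p e = edge_column p {s e, t e}"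
        using st[OF that] by metis
      \<comment> \<open>The translation b cancels in the difference, and a skew-symmetric matrix
        sends p (s e) - p (t e) to a vector perpendicular to it, hence to the edge
        direction.\<close>
      have "edge_column p e \<bullet> m A b = ?d \<bullet> (A *v (p (s e) - p (t e)))"
        unfolding e by (simp add: m_def edge_column_dot_stack[OF ne] matrix_vector_mult_diff_distrib)
      also have "\<dots> = 0"
        using A by (simp add: edge_dir_eq skew_symmetric_dot skew_def)
      finally have "edge_column p e \<bullet> m A b = 0" .
      moreover have "edge_column p e \<bullet> z = (f $ s e - f $ t e) * (?d \<bullet> w)"
        unfolding e
        by (simp add: z_def edge_column_dot_stack[OF ne] inner_diff_right left_diff_distrib)
      ultimately have eq: "edge_column p e \<bullet> x = c * (f $ s e - f $ t e) * (?d \<bullet> w)"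
        by (simp add: x inner_add_right)
      have "\<bar>?d \<bullet> w\<bar> \<le> 1"
        using Cauchy_Schwarz_ineq2[of ?d w] norm_edge_dir_le[of p "s e" "t e"] w(1) by simp
      then have "(?d \<bullet> w)\<^sup>2 \<le> 1"
        by (simp add: abs_square_le_1)
      then show ?thesis
        unfolding eq power_mult_distrib by (intro mult_left_le) auto
    qed
    have "a \<ge> 0"
      using laplacian_form_nonneg[OF E, of f] f(3) by linarith
    have "x \<bullet> (stiffness_matrix E p *v x) \<le> (\<Sum>e\<in>E. c\<^sup>2 * (f $ s e - f $ t e)\<^sup>2)"
      unfolding stiffness_matrix_form by (intro sum_mono col)
    also have "\<dots> = c\<^sup>2 * (f \<bullet> (laplacian E *v f))"
      by (simp only: laplacian_form[OF st] sum_distrib_left)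
    also have "\<dots> \<le> c\<^sup>2 * a"
      using f(3) by (simp add: mult_left_mono)
    \<comment> \<open>Nonnegativity of a is what allows the squared length of the trivial motion to
      be added on the right.\<close>
    also have "\<dots> \<le> a * (x \<bullet> x)"
      using \<open>a \<ge> 0\<close> by (simp add: x norm_sq[OF A] distrib_left)
    finally show ?thesis .
  qed
  ultimately show thesis
    using that linear_subspace_image[OF \<open>linear \<Psi>\<close> X] by blast
qed

section \<open>Perturbing a placement into a spanning one\<close>

lemma tendsto_edge_column:
  assumes "p u \<noteq> p v"
  shows "((\<lambda>t. edge_column (\<lambda>x. p x + t *\<^sub>R q x) {u, v}) \<longlongrightarrow> edge_column p {u, v}) (at 0)"
proof -
  have "u \<noteq> v" using assms by auto
  have "((\<lambda>t. (1 / norm (p u + t *\<^sub>R q u - (p v + t *\<^sub>R q v))) *\<^sub>R (p u + t *\<^sub>R q u - (p v + t *\<^sub>R q v)))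
      \<longlongrightarrow> (1 / norm (p u + 0 *\<^sub>R q u - (p v + 0 *\<^sub>R q v))) *\<^sub>R (p u + 0 *\<^sub>R q u - (p v + 0 *\<^sub>R q v))) (at 0)"
    using assms by (intro tendsto_intros) auto
  then have "((\<lambda>t. edge_dir (\<lambda>x. p x + t *\<^sub>R q x) u v) \<longlongrightarrow> edge_dir p u v) (at 0)"
    by (simp add: edge_dir_eq)
  then show ?thesis
    unfolding edge_column_doubleton[OF \<open>u \<noteq> v\<close>] kron_vec_def
    by (intro vec_tendstoI) (auto intro!: tendsto_intros)
qed

text \<open>The columns of edges collapsed by \<open>p\<close> need not converge as \<open>t\<close> tends to 0; they contribute
  zero on the left and a nonnegative amount on the right.\<close>

lemma stiffness_matrix_form_perturbation:
  fixes E :: "'v::finite set set" and p q :: "'v \<Rightarrow> real^'d"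
  assumes E: "simple_graph E" and "\<epsilon> > 0"
  shows "\<forall>\<^sub>F t in at 0. \<forall>x. x \<bullet> (stiffness_matrix E p *v x)
    \<le> x \<bullet> (stiffness_matrix E (\<lambda>u. p u + t *\<^sub>R q u) *v x) + \<epsilon> * (x \<bullet> x)"
proof -
  define c where "c t e = edge_column (\<lambda>u. p u + t *\<^sub>R q u) e" for t e
  \<comment> \<open>The bound comes from factoring a difference of squares and applying
    Cauchy-Schwarz to each factor. It does not involve x, so one t serves all x.\<close>
  define \<delta> where "\<delta> t e = (if edge_column p e = 0 then 0
    else norm (edge_column p e - c t e) * norm (edge_column p e + c t e))" for t e
  have "((\<lambda>t. \<delta> t e) \<longlongrightarrow> 0) (at 0)" if "e \<in> E" for e
  proof (cases "edge_column p e = 0")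
    case True
    then show ?thesis by (simp add: \<delta>_def)
  next
    case False
    have "card e = 2"
      using E that by (simp add: simple_graph_def)
    then obtain u v where uv: "e = {u, v}" "u \<noteq> v"
      by (auto simp: card_2_iff)
    have "p u \<noteq> p v"
    proof
      assume "p u = p v"
      then have "edge_column p e = 0"
        using uv by (simp add: edge_column_doubleton edge_dir_def kron_vec_def vec_eq_iff)
      with False show False by simp
    qed
    then have "((\<lambda>t. c t e) \<longlongrightarrow> edge_column p e) (at 0)"
      unfolding c_def uv by (rule tendsto_edge_column)
    then have "((\<lambda>t. norm (edge_column p e - c t e) * norm (edge_column p e + c t e))
       \<longlongrightarrow> norm (edge_column p e - edge_column p e) * norm (edge_column p e + edge_column p e)) (at 0)"
      by (intro tendsto_intros)
    then show ?thesis
      using False by (simp add: \<delta>_def)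
  qed
  then have "((\<lambda>t. \<Sum>e\<in>E. \<delta> t e) \<longlongrightarrow> (\<Sum>e\<in>E. 0)) (at 0)"
    by (intro tendsto_sum)
  then have "\<forall>\<^sub>F t in at 0. (\<Sum>e\<in>E. \<delta> t e) < \<epsilon>"
    using order_tendstoD(2) \<open>\<epsilon> > 0\<close> by fastforce
  then show ?thesis
  proof (rule eventually_mono, intro allI)
    fix t x
    assume small: "(\<Sum>e\<in>E. \<delta> t e) < \<epsilon>"
    have "(edge_column p e \<bullet> x)\<^sup>2 \<le> (c t e \<bullet> x)\<^sup>2 + \<delta> t e * (x \<bullet> x)" for e
    proof (cases "edge_column p e = 0")
      case False
      have "(edge_column p e \<bullet> x)\<^sup>2 - (c t e \<bullet> x)\<^sup>2
          = ((edge_column p e - c t e) \<bullet> x) * ((edge_column p e + c t e) \<bullet> x)"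
        by (simp add: inner_diff_left inner_add_left power2_eq_square algebra_simps)
      also have "\<dots> \<le> \<bar>(edge_column p e - c t e) \<bullet> x\<bar> * \<bar>(edge_column p e + c t e) \<bullet> x\<bar>"
        by (metis abs_ge_self abs_mult)
      also have "\<dots> \<le> (norm (edge_column p e - c t e) * norm x) * (norm (edge_column p e + c t e) * norm x)"
        by (intro mult_mono Cauchy_Schwarz_ineq2) auto
      also have "\<dots> = \<delta> t e * (x \<bullet> x)"
        using False by (simp add: \<delta>_def dot_square_norm power2_eq_square)
      finally show ?thesis by simp
    qed (simp add: \<delta>_def)
    then have "(\<Sum>e\<in>E. (edge_column p e \<bullet> x)\<^sup>2) \<le> (\<Sum>e\<in>E. (c t e \<bullet> x)\<^sup>2 + \<delta> t e * (x \<bullet> x))"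
      by (rule sum_mono)
    also have "\<dots> = (\<Sum>e\<in>E. (c t e \<bullet> x)\<^sup>2) + (\<Sum>e\<in>E. \<delta> t e) * (x \<bullet> x)"
      by (simp add: sum.distrib sum_distrib_right)
    also have "\<dots> \<le> (\<Sum>e\<in>E. (c t e \<bullet> x)\<^sup>2) + \<epsilon> * (x \<bullet> x)"
      using small by (intro add_left_mono mult_right_mono) auto
    finally show "x \<bullet> (stiffness_matrix E p *v x)
        \<le> x \<bullet> (stiffness_matrix E (\<lambda>u. p u + t *\<^sub>R q u) *v x) + \<epsilon> * (x \<bullet> x)"
      by (simp add: stiffness_matrix_form c_def)
  qed
qed

text \<open>The determinant is the characteristic polynomial of -P at t; a nonzero polynomial has
  finitely many roots, and these cannot accumulate at 0.\<close>

lemma eventually_det_perturbation_nonzero: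
  fixes P :: "real^'n^'n"
  shows "\<forall>\<^sub>F t in at 0. det (t *\<^sub>R mat 1 + P) \<noteq> 0"
proof -
  \<comment> \<open>A shift larger than the operator norm of \<open>P\<close> makes the matrix
    injective, so the polynomial is not identically zero.\<close>
  define t0 where "t0 = onorm (\<lambda>x. P *v x) + 1"
  have bl: "bounded_linear (\<lambda>x. P *v x)"
    by (simp add: linear_conv_bounded_linear[symmetric])
  have "x = 0" if "(t0 *\<^sub>R mat 1 + P) *v x = 0" for x
  proof -
    have "t0 *\<^sub>R x = - (P *v x)"
      using that by (simp add: matrix_vector_mult_add_rdistrib scaleR_matrix_vector_assoc[symmetric]
          add_eq_0_iff)
    then have "\<bar>t0\<bar> * norm x = norm (P *v x)"
      by (metis norm_minus_cancel norm_scaleR)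
    moreover have "norm (P *v x) \<le> onorm (\<lambda>x. P *v x) * norm x"
      by (rule onorm[OF bl])
    ultimately have "(onorm (\<lambda>x. P *v x) + 1) * norm x \<le> onorm (\<lambda>x. P *v x) * norm x"
      using onorm_pos_le[OF bl] by (simp add: t0_def)
    then show ?thesis
      by (simp add: distrib_right)
  qed
  then have "det (t0 *\<^sub>R mat 1 + P) \<noteq> 0"
    by (metis invertible_det_nz invertible_left_inverse matrix_left_invertible_ker)
  then have nz: "char_poly_mat (- P) \<noteq> 0"
    using poly_char_poly_mat[of "- P" t0] by auto
  have "\<forall>\<^sub>F t in at 0. t \<notin> {t. poly (char_poly_mat (- P)) t = 0}"
    using islimpt_finite[OF poly_roots_finite[OF nz]] by (simp add: islimpt_iff_eventually)
  then show ?thesis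
    by (simp add: poly_char_poly_mat)
qed

lemma eventually_perturbation_spans:
  fixes p :: "'v::finite \<Rightarrow> real^'d"
  assumes "CARD('d) \<le> CARD('v)"
  obtains q where "\<forall>\<^sub>F t in at 0. span (range (\<lambda>u. p u + t *\<^sub>R q u)) = UNIV"
proof -
  obtain \<sigma> :: "'d \<Rightarrow> 'v" where \<sigma>: "inj \<sigma>"
    using card_le_inj[of "UNIV :: 'd set" "UNIV :: 'v set"] assms by auto
  \<comment> \<open>The vertex \<sigma> i moves along the i-th axis, so the d selected points become
    the rows of tI + P. The remaining points can only enlarge the span.\<close>
  define q :: "'v \<Rightarrow> real^'d" where "q u = axis (inv \<sigma> u) 1" for u
  define P :: "real^'d^'d" where "P = (\<chi> i. p (\<sigma> i))"
  have spans: "span (range (\<lambda>u. p u + t *\<^sub>R q u)) = UNIV" if "det (t *\<^sub>R mat 1 + P) \<noteq> 0" for t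
  proof -
    have "row i (t *\<^sub>R mat 1 + P) = p (\<sigma> i) + t *\<^sub>R q (\<sigma> i)" for i
      using \<sigma> by (auto simp: row_def P_def q_def mat_def axis_def vec_eq_iff)
    then have "rows (t *\<^sub>R mat 1 + P) \<subseteq> range (\<lambda>u. p u + t *\<^sub>R q u)"
      by (auto simp: rows_def)
    moreover have "span (rows (t *\<^sub>R mat 1 + P)) = UNIV"
      using that by (metis invertible_det_nz invertible_left_inverse matrix_left_invertible_span_rows)
    ultimately show ?thesis
      using span_mono by blast
  qed
  show thesis
    by (rule that, rule eventually_mono[OF eventually_det_perturbation_nonzero[of P]]) (rule spans)
qed

text \<open>The vector f depends on the graph alone and is fixed before perturbing. For each
  \<epsilon> a single t suffices: the test space of the perturbed placement also bounds the form of
  \<open>p\<close>, up to \<epsilon>, so no limit of subspaces is taken.\<close>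

lemma nth_eigenvalue_stiffness_matrix_le:
  fixes E :: "'v::finite set set" and p :: "'v \<Rightarrow> real^'d"
  assumes E: "simple_graph E" and "2 \<le> CARD('v)" "CARD('d) \<le> CARD('v)"
  shows "nth_eigenvalue (((CARD('d) + 1) choose 2) + 1) (stiffness_matrix E p)
    \<le> algebraic_connectivity E"
proof (rule field_le_epsilon)
  fix \<epsilon> :: real
  assume "\<epsilon> > 0"
  obtain f :: "real^'v" where f: "norm f = 1" "(\<Sum>u\<in>UNIV. f $ u) = 0"
    "f \<bullet> (laplacian E *v f) \<le> algebraic_connectivity E"
    using algebraic_connectivity_test_vector[OF assms(2)] by blast
  obtain q where q: "\<forall>\<^sub>F t in at 0. span (range (\<lambda>u. p u + t *\<^sub>R q u)) = UNIV"
    using eventually_perturbation_spans[OF assms(3)] by blast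
  have "\<exists>t. span (range (\<lambda>u. p u + t *\<^sub>R q u)) = UNIV \<and>
    (\<forall>x. x \<bullet> (stiffness_matrix E p *v x)
      \<le> x \<bullet> (stiffness_matrix E (\<lambda>u. p u + t *\<^sub>R q u) *v x) + \<epsilon> * (x \<bullet> x))"
    using eventually_conj[OF q stiffness_matrix_form_perturbation[OF E \<open>\<epsilon> > 0\<close>, of p q]]
    by (rule eventually_happens'[rotated]) simp
  then obtain t where t: "span (range (\<lambda>u. p u + t *\<^sub>R q u)) = UNIV"
    "\<And>x. x \<bullet> (stiffness_matrix E p *v x)
      \<le> x \<bullet> (stiffness_matrix E (\<lambda>u. p u + t *\<^sub>R q u) *v x) + \<epsilon> * (x \<bullet> x)"
    by blast
  obtain W where W: "subspace W" "((CARD('d) + 1) choose 2) + 1 \<le> dim W"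
    "\<And>x. x \<in> W \<Longrightarrow> x \<bullet> (stiffness_matrix E (\<lambda>u. p u + t *\<^sub>R q u) *v x)
      \<le> algebraic_connectivity E * (x \<bullet> x)"
    using stiffness_matrix_test_space[OF E t(1) f] by blast
  show "nth_eigenvalue (((CARD('d) + 1) choose 2) + 1) (stiffness_matrix E p)
    \<le> algebraic_connectivity E + \<epsilon>"
  proof (rule nth_eigenvalue_le[OF transpose_stiffness_matrix W(1,2)])
    show "x \<bullet> (stiffness_matrix E p *v x) \<le> (algebraic_connectivity E + \<epsilon>) * (x \<bullet> x)"
      if "x \<in> W" for x
      using t(2)[of x] W(3)[OF that] by (simp add: distrib_right)
  qed simp
qed

text \<open>For |V| >= d >= 2 the index (d + 1 choose 2) + 1 is at most d * |V|, since (d - 2) * (d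
  + 1) >= 0; hence the eigenvalue on the left exists.\<close>

theorem theorem1p6:
  fixes E :: "'v::finite set set"
  assumes "simple_graph E"
    and "2 \<le> CARD('d::finite)"
    and "CARD('d) \<le> CARD('v)"
  shows "algebraic_connectivity_dim TYPE('d) E \<le> ereal (algebraic_connectivity E)"
  unfolding algebraic_connectivity_dim_def
proof (rule SUP_least)
  fix p :: "'v \<Rightarrow> real^'d"
  have "2 \<le> CARD('v)"
    using assms by linarith
  then show "ereal (nth_eigenvalue (((CARD('d) + 1) choose 2) + 1) (stiffness_matrix E p))
      \<le> ereal (algebraic_connectivity E)"
    using nth_eigenvalue_stiffness_matrix_le[OF assms(1) _ assms(3)] by simp
qed

end
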